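(* Any graph $X$ has a basing $p:X\to B$.
   Context: A graph is $X=(X_0,X_1,s,t)$ with a set $X_0$ of nodes, a set $X_1$ of arcs, and functions $s,t:X_1\to X_0$ (source and target); loops, multiple arcs and infinite graphs are allowed. Graph morphisms are pairs of functions on nodes and arcs commuting with $s$ and $t$. $X( *,x)$ denotes the set of arcs of $X$ with target the node $x$. A graph morphism $f:X\to Y$ is a covering when $f:X( *,x)\to Y( *,f(x))$ is a bijection for every node $x$ of $X$; it is an epic covering when it is moreover surjective on nodes (and thus on arcs). A graph $B$ is basal when the only epic coverings $B\to B'$ are isomorphisms. A basing for $X$ is an epic covering $p:X\to B$ where $B$ is basal. *)

theory Defs
  imports "Graph_Theory.Digraph"
begin

text \<open>
  Graphs (loops, multiple arcs and infinite graphs allowed) are the records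
  \<^typ>\<open>('a, 'b) pre_digraph\<close> satisfying \<^const>\<open>wf_digraph\<close>, with \<^const>\<open>tail\<close> as the source map
  and \<^const>\<open>head\<close> as the target map. The set X(*,x) is \<^term>\<open>in_arcs X x\<close>. Maps between graphs
  matter only through their values on \<^const>\<open>verts\<close> and \<^const>\<open>arcs\<close>.
\<close>

type_synonym ('a, 'b, 'c, 'd) graph_map = "('a \<Rightarrow> 'c) \<times> ('b \<Rightarrow> 'd)"

definition graph_morphism ::
    "('a, 'b) pre_digraph \<Rightarrow> ('c, 'd) pre_digraph \<Rightarrow> ('a, 'b, 'c, 'd) graph_map \<Rightarrow> bool" where
  "graph_morphism X Y f \<longleftrightarrow>
     wf_digraph X \<and> wf_digraph Y \<and>
     (\<forall>x \<in> verts X. fst f x \<in> verts Y) \<and>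
     (\<forall>a \<in> arcs X. snd f a \<in> arcs Y \<and>
        tail Y (snd f a) = fst f (tail X a) \<and>
        head Y (snd f a) = fst f (head X a))"

definition graph_iso ::
    "('a, 'b) pre_digraph \<Rightarrow> ('c, 'd) pre_digraph \<Rightarrow> ('a, 'b, 'c, 'd) graph_map \<Rightarrow> bool" where
  "graph_iso X Y f \<longleftrightarrow>
     graph_morphism X Y f \<and>
     (\<exists>g. graph_morphism Y X g \<and>
        (\<forall>x \<in> verts X. fst g (fst f x) = x) \<and> (\<forall>a \<in> arcs X. snd g (snd f a) = a) \<and>
        (\<forall>y \<in> verts Y. fst f (fst g y) = y) \<and> (\<forall>b \<in> arcs Y. snd f (snd g b) = b))"

definition covering ::
    "('a, 'b) pre_digraph \<Rightarrow> ('c, 'd) pre_digraph \<Rightarrow> ('a, 'b, 'c, 'd) graph_map \<Rightarrow> bool" where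
  "covering X Y f \<longleftrightarrow>
     graph_morphism X Y f \<and>
     (\<forall>x \<in> verts X. bij_betw (snd f) (in_arcs X x) (in_arcs Y (fst f x)))"

definition epic_covering ::
    "('a, 'b) pre_digraph \<Rightarrow> ('c, 'd) pre_digraph \<Rightarrow> ('a, 'b, 'c, 'd) graph_map \<Rightarrow> bool" where
  "epic_covering X Y f \<longleftrightarrow> covering X Y f \<and> fst f ` verts X = verts Y"

text \<open>
  HOL cannot quantify over types inside a definition, so the graphs B' below have the same node
  and arc types as B. This loses nothing, because an epic covering is surjective on nodes and
  arcs: \<open>basal_epic_covering_iso\<close> below gives the condition for B' over arbitrary types.
\<close>

definition basal :: "('a, 'b) pre_digraph \<Rightarrow> bool" where
  "basal B \<longleftrightarrow>
     wf_digraph B \<and>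
     (\<forall>(B' :: ('a, 'b) pre_digraph) f. epic_covering B B' f \<longrightarrow> graph_iso B B' f)"

definition basing ::
    "('a, 'b) pre_digraph \<Rightarrow> ('c, 'd) pre_digraph \<Rightarrow> ('a, 'b, 'c, 'd) graph_map \<Rightarrow> bool" where
  "basing X B p \<longleftrightarrow> epic_covering X B p \<and> basal B"

lemma epic_covering_arcs:
  assumes "epic_covering X Y f"
  shows "snd f ` arcs X = arcs Y"
proof
  show "snd f ` arcs X \<subseteq> arcs Y"
    using assms by (auto simp: epic_covering_def covering_def graph_morphism_def)
  show "arcs Y \<subseteq> snd f ` arcs X"
  proof
    fix b assume b: "b \<in> arcs Y"
    have "head Y b \<in> verts Y"
      using assms b
      by (auto simp: epic_covering_def covering_def graph_morphism_def wf_digraph_def)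
    then obtain x where x: "x \<in> verts X" "head Y b = fst f x"
      using assms unfolding epic_covering_def by force
    have "bij_betw (snd f) (in_arcs X x) (in_arcs Y (fst f x))"
      using assms x by (auto simp: epic_covering_def covering_def)
    moreover have "b \<in> in_arcs Y (fst f x)" using b x by (simp add: in_arcs_def)
    ultimately have "b \<in> snd f ` in_arcs X x" by (simp add: bij_betw_def)
    then show "b \<in> snd f ` arcs X" by (auto simp: in_arcs_def)
  qed
qed

lemma graph_isoI:
  assumes m: "graph_morphism X Y f"
    and v: "bij_betw (fst f) (verts X) (verts Y)"
    and a: "bij_betw (snd f) (arcs X) (arcs Y)"
  shows "graph_iso X Y f"
proof -
  let ?u = "inv_into (verts X) (fst f)" and ?w = "inv_into (arcs X) (snd f)"
  have ux: "?u (fst f x) = x" if "x \<in> verts X" for x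
    using v that by (simp add: bij_betw_inv_into_left)
  have wx: "?w (snd f b) = b" if "b \<in> arcs X" for b
    using a that by (simp add: bij_betw_inv_into_left)
  have fu: "?u y \<in> verts X \<and> fst f (?u y) = y" if "y \<in> verts Y" for y
    using v that by (metis bij_betw_def f_inv_into_f inv_into_into)
  have fw: "?w b \<in> arcs X \<and> snd f (?w b) = b" if "b \<in> arcs Y" for b
    using a that by (metis bij_betw_def f_inv_into_f inv_into_into)
  have wfX: "wf_digraph X" and wfY: "wf_digraph Y" using m by (auto simp: graph_morphism_def)
  have "tail X (?w b) = ?u (tail Y b) \<and> head X (?w b) = ?u (head Y b)" if b: "b \<in> arcs Y" for b
  proof -
    have w: "?w b \<in> arcs X" "snd f (?w b) = b" using fw b by auto
    then have "tail Y b = fst f (tail X (?w b))" "head Y b = fst f (head X (?w b))"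
      using m unfolding graph_morphism_def by metis+
    then show ?thesis using ux w wfX by (simp add: wf_digraph_def)
  qed
  then have "graph_morphism Y X (?u, ?w)"
    using fu fw wfX wfY by (simp add: graph_morphism_def)
  then show ?thesis
    unfolding graph_iso_def using m ux wx fu fw
    by (intro conjI exI[of _ "(?u, ?w)"]) auto
qed

theorem basal_epic_covering_iso:
  fixes B :: "('a, 'b) pre_digraph" and B' :: "('c, 'd) pre_digraph"
  assumes bas: "basal B" and epi: "epic_covering B B' f"
  shows "graph_iso B B' f"
proof -
  have m: "graph_morphism B B' f" and vs: "fst f ` verts B = verts B'"
    and bij: "\<And>x. x \<in> verts B \<Longrightarrow> bij_betw (snd f) (in_arcs B x) (in_arcs B' (fst f x))"
    using epi by (auto simp: epic_covering_def covering_def)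
  have as: "snd f ` arcs B = arcs B'" using epi by (rule epic_covering_arcs)
  have wf: "wf_digraph B" "wf_digraph B'" using m by (auto simp: graph_morphism_def)
  define u where "u = inv_into (verts B) (fst f)"
  define w where "w = inv_into (arcs B) (snd f)"
  have iu: "inj_on u (verts B')" and iw: "inj_on w (arcs B')"
    unfolding u_def w_def using vs as by (auto intro: inj_on_inv_into)
  define C :: "('a, 'b) pre_digraph" where
    "C = \<lparr>verts = u ` verts B', arcs = w ` arcs B',
          tail = u \<circ> tail B' \<circ> snd f, head = u \<circ> head B' \<circ> snd f\<rparr>"
  have fw: "snd f (w b) = b" if "b \<in> arcs B'" for b
    unfolding w_def using that as by (simp add: f_inv_into_f)
  let ?h = "(u \<circ> fst f, w \<circ> snd f)"
  have wfC: "wf_digraph C"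
    using wf fw by (auto simp: C_def wf_digraph_def)
  have mor: "graph_morphism B C ?h"
    using m wf wfC vs as fw
    unfolding graph_morphism_def by (auto simp: C_def)
  have inC: "in_arcs C (u y) = w ` in_arcs B' y" if y: "y \<in> verts B'" for y
    using iu fw wf y by (auto simp: C_def in_arcs_def wf_digraph_def inj_on_eq_iff)
  have "bij_betw (w \<circ> snd f) (in_arcs B x) (in_arcs C (u (fst f x)))" if x: "x \<in> verts B" for x
  proof (rule bij_betw_trans[OF bij[OF x]])
    have "fst f x \<in> verts B'" using vs x by auto
    moreover have "inj_on w (in_arcs B' (fst f x))"
      using iw by (rule inj_on_subset) (auto simp: in_arcs_def)
    ultimately show "bij_betw w (in_arcs B' (fst f x)) (in_arcs C (u (fst f x)))"
      using inC by (simp add: bij_betw_def)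
  qed
  moreover have "(u \<circ> fst f) ` verts B = verts C"
    by (simp add: C_def image_image flip: vs)
  ultimately have "epic_covering B C ?h"
    using mor by (simp add: epic_covering_def covering_def)
  then have "graph_iso B C ?h" using bas by (simp add: basal_def)
  then obtain g where g: "\<forall>x \<in> verts B. fst g (u (fst f x)) = x"
      "\<forall>b \<in> arcs B. snd g (w (snd f b)) = b"
    unfolding graph_iso_def by auto
  have "inj_on (fst f) (verts B)" "inj_on (snd f) (arcs B)"
    using g by (auto intro!: inj_onI) metis+
  then show ?thesis
    using m vs as by (intro graph_isoI) (auto simp: bij_betw_def)
qed

end

(*
  Call two nodes x and y bisimilar when their sets of incoming arcs are in bijection in such a way
  that the sources of corresponding arcs are again bisimilar, taken coinductively. This is an
  equivalence relation, and the quotient that keeps the incoming arcs of one representative of each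
  class is covered by X. Nodes identified by any covering are bisimilar; hence, for an epic covering
  f of the quotient, nodes of X identified by the composite with f are already identified in the
  quotient, so that f is injective.
*)
theory Submission
  imports Defs
begin

lemma covering_comp:
  assumes "covering X Y f" "covering Y Z g"
  shows "covering X Z (fst g \<circ> fst f, snd g \<circ> snd f)"
  using assms unfolding covering_def graph_morphism_def
  by (auto intro: bij_betw_trans)

text \<open>Arcs with the same image have heads with the same image, hence the same head; a covering
  is injective on the arcs into one node.\<close>

lemma covering_inj_on_arcs:
  assumes cov: "covering X Y f" and inj: "inj_on (fst f) (verts X)"
  shows "inj_on (snd f) (arcs X)"
proof (rule inj_onI)
  fix a b assume ab: "a \<in> arcs X" "b \<in> arcs X" "snd f a = snd f b"
  have wf: "wf_digraph X" and hd: "\<And>c. c \<in> arcs X \<Longrightarrow> head Y (snd f c) = fst f (head X c)"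
    using cov by (auto simp: covering_def graph_morphism_def)
  have v: "head X a \<in> verts X" "head X b \<in> verts X"
    using wf ab by (auto simp: wf_digraph_def)
  have "head X a = head X b"
    using inj v hd[OF ab(1)] hd[OF ab(2)] ab(3) by (auto dest: inj_onD)
  moreover have "inj_on (snd f) (in_arcs X (head X a))"
    using cov v by (auto simp: covering_def bij_betw_def)
  ultimately show "a = b" using ab by (auto dest: inj_onD)
qed

text \<open>Equivalently, the trees of backward paths from \<open>x\<close> and \<open>y\<close> are
  isomorphic. The greatest fixed point is essential: the least one would relate only nodes without
  infinite backward paths.\<close>

coinductive bisimilar :: "('a, 'b) pre_digraph \<Rightarrow> 'a \<Rightarrow> 'a \<Rightarrow> bool"
  for X :: "('a, 'b) pre_digraph" where
  "x \<in> verts X \<Longrightarrow> y \<in> verts X \<Longrightarrow> bij_betw \<phi> (in_arcs X x) (in_arcs X y) \<Longrightarrow>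
   \<forall>a \<in> in_arcs X x. bisimilar X (tail X a) (tail X (\<phi> a)) \<Longrightarrow> bisimilar X x y"

text \<open>The kernel of \<open>fst f\<close> on nodes satisfies the coinduction rule: push an arc
  into \<open>x\<close> forward along \<open>f\<close> and lift it to an arc into \<open>y\<close>.
  Both arcs have the same image, so their sources do too.\<close>

lemma covering_eq_imp_bisimilar:
  assumes cov: "covering X Y f" and "x \<in> verts X" "y \<in> verts X" "fst f x = fst f y"
  shows "bisimilar X x y"
  using assms(2-)
proof (coinduction arbitrary: x y)
  case bisimilar
  have m: "graph_morphism X Y f" and wf: "wf_digraph X"
    and bx: "bij_betw (snd f) (in_arcs X x) (in_arcs Y (fst f x))"
    and bz: "bij_betw (snd f) (in_arcs X y) (in_arcs Y (fst f x))"
    using cov bisimilar by (auto simp: covering_def graph_morphism_def)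
  define \<phi> where "\<phi> = inv_into (in_arcs X y) (snd f) \<circ> snd f"
  have bij: "bij_betw \<phi> (in_arcs X x) (in_arcs X y)"
    unfolding \<phi>_def by (rule bij_betw_trans[OF bx bij_betw_inv_into[OF bz]])
  have tl: "tail X a \<in> verts X \<and> tail X (\<phi> a) \<in> verts X \<and> fst f (tail X a) = fst f (tail X (\<phi> a))"
    if a: "a \<in> in_arcs X x" for a
  proof -
    have "\<phi> a \<in> in_arcs X y" using bij a by (rule bij_betw_apply)
    moreover have "snd f (\<phi> a) = snd f a"
      unfolding \<phi>_def using bij_betw_inv_into_right[OF bz bij_betw_apply[OF bx a]] by simp
    ultimately show ?thesis
      using m wf a by (auto simp: graph_morphism_def wf_digraph_def) metis
  qed
  show ?case using bisimilar bij tl by blast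
qed

lemma bisimilar_refl:
  assumes "wf_digraph X" "x \<in> verts X"
  shows "bisimilar X x x"
proof (rule covering_eq_imp_bisimilar[of X X "(id, id)"])
  show "covering X X (id, id)"
    using assms by (auto simp: covering_def graph_morphism_def)
qed (use assms in auto)

lemma bisimilar_sym:
  assumes "bisimilar X x y"
  shows "bisimilar X y x"
  using assms
proof (coinduction arbitrary: x y)
  case bisimilar
  then obtain \<phi> where v: "x \<in> verts X" "y \<in> verts X"
    and b: "bij_betw \<phi> (in_arcs X x) (in_arcs X y)"
    and t: "\<forall>a \<in> in_arcs X x. bisimilar X (tail X a) (tail X (\<phi> a))"
    by cases blast
  let ?\<psi> = "inv_into (in_arcs X x) \<phi>"
  have b': "bij_betw ?\<psi> (in_arcs X y) (in_arcs X x)" using b by (rule bij_betw_inv_into)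
  have "bisimilar X (tail X (?\<psi> a)) (tail X a)" if a: "a \<in> in_arcs X y" for a
    using t bij_betw_apply[OF b' a] bij_betw_inv_into_right[OF b a] by metis
  then show ?case using v b' by blast
qed

lemma bisimilar_trans:
  assumes "bisimilar X x y" "bisimilar X y z"
  shows "bisimilar X x z"
  using assms
proof (coinduction arbitrary: x y z)
  case bisimilar
  obtain \<phi> where v: "x \<in> verts X"
    and b: "bij_betw \<phi> (in_arcs X x) (in_arcs X y)"
    and t: "\<forall>a \<in> in_arcs X x. bisimilar X (tail X a) (tail X (\<phi> a))"
    using bisimilar(1) by cases blast
  obtain \<psi> where v': "z \<in> verts X"
    and b': "bij_betw \<psi> (in_arcs X y) (in_arcs X z)"
    and t': "\<forall>a \<in> in_arcs X y. bisimilar X (tail X a) (tail X (\<psi> a))"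
    using bisimilar(2) by cases blast
  \<comment> \<open>The source of \<open>\<phi> a\<close> serves as the intermediate node at the
    next level.\<close>
  have "bisimilar X (tail X (\<phi> a)) (tail X ((\<psi> \<circ> \<phi>) a))" if "a \<in> in_arcs X x" for a
    using t' bij_betw_apply[OF b that] by simp
  then show ?case using v v' bij_betw_trans[OF b b'] t by blast
qed

definition bisim_rep :: "('a, 'b) pre_digraph \<Rightarrow> 'a \<Rightarrow> 'a" where
  "bisim_rep X x = (SOME y. bisimilar X x y)"

lemma bisimilar_rep:
  assumes "wf_digraph X" "x \<in> verts X"
  shows "bisimilar X x (bisim_rep X x)"
  unfolding bisim_rep_def using bisimilar_refl[OF assms] by (rule someI)

lemma bisim_rep_eq:
  assumes "bisimilar X x y"
  shows "bisim_rep X x = bisim_rep X y"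
proof -
  \<comment> \<open>Bisimilar nodes have the same class as a predicate, so \<open>SOME\<close>
    chooses the same element.\<close>
  have "bisimilar X x = bisimilar X y"
    using assms by (auto intro: bisimilar_sym bisimilar_trans)
  then show ?thesis by (simp add: bisim_rep_def)
qed

text \<open>Arcs into other members of a class are discarded, so each class keeps one copy of its
  incoming arcs. Heads are then already representatives and only tails must be moved. Nodes and arcs
  keep the types of \<open>X\<close>.\<close>

definition bisim_quotient :: "('a, 'b) pre_digraph \<Rightarrow> ('a, 'b) pre_digraph" where
  "bisim_quotient X =
     \<lparr>verts = bisim_rep X ` verts X, arcs = {a \<in> arcs X. head X a \<in> bisim_rep X ` verts X},
      tail = bisim_rep X \<circ> tail X, head = head X\<rparr>"

lemma bisim_quotient_epic_covering:
  assumes wf: "wf_digraph X"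
  obtains q where "epic_covering X (bisim_quotient X) (bisim_rep X, q)"
proof -
  let ?r = "bisim_rep X" and ?Q = "bisim_quotient X"
  have "\<exists>\<phi>. bij_betw \<phi> (in_arcs X x) (in_arcs X (?r x)) \<and>
      (\<forall>a \<in> in_arcs X x. bisimilar X (tail X a) (tail X (\<phi> a)))" if "x \<in> verts X" for x
    using bisimilar_rep[OF wf that] by cases blast
  then obtain \<phi> where
    b: "\<And>x. x \<in> verts X \<Longrightarrow> bij_betw (\<phi> x) (in_arcs X x) (in_arcs X (?r x))" and
    t: "\<And>x a. x \<in> verts X \<Longrightarrow> a \<in> in_arcs X x \<Longrightarrow> bisimilar X (tail X a) (tail X (\<phi> x a))"
    by metis
  \<comment> \<open>Each arc is carried by the bijection chosen for its own head, so on the arcs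
    into \<open>x\<close> the map \<open>q\<close> agrees with \<open>\<phi> x\<close>.\<close>
  define q where "q a = \<phi> (head X a) a" for a
  have vertsQ: "verts ?Q = ?r ` verts X" by (simp add: bisim_quotient_def)
  have wfQ: "wf_digraph ?Q"
    using wf by (auto simp: bisim_quotient_def wf_digraph_def)
  have inQ: "in_arcs ?Q (?r x) = in_arcs X (?r x)" if "x \<in> verts X" for x
    using that by (auto simp: bisim_quotient_def in_arcs_def)
  have q: "q a \<in> arcs ?Q \<and> tail ?Q (q a) = ?r (tail X a) \<and> head ?Q (q a) = ?r (head X a)"
    if a: "a \<in> arcs X" for a
  proof -
    have h: "head X a \<in> verts X" and a': "a \<in> in_arcs X (head X a)"
      using wf a by (auto simp: wf_digraph_def)
    have "q a \<in> in_arcs ?Q (?r (head X a))"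
      unfolding q_def inQ[OF h] using b[OF h] a' by (rule bij_betw_apply)
    \<comment> \<open>Compatibility with sources is where the coinductive clause enters:
      \<open>q\<close> may change the source of an arc, but only within its class.\<close>
    moreover have "?r (tail X (q a)) = ?r (tail X a)"
      unfolding q_def using bisim_rep_eq[OF t[OF h a']] by simp
    ultimately show ?thesis using h by (auto simp: bisim_quotient_def)
  qed
  have "bij_betw q (in_arcs X x) (in_arcs ?Q (?r x))" if x: "x \<in> verts X" for x
    unfolding inQ[OF x] using b[OF x] by (rule bij_betw_cong[THEN iffD1, rotated]) (simp add: q_def)
  then have "epic_covering X ?Q (?r, q)"
    using wf wfQ q vertsQ by (simp add: epic_covering_def covering_def graph_morphism_def)
  then show ?thesis by (rule that)
qed

lemma basal_bisim_quotient:
  assumes wf: "wf_digraph X"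
  shows "basal (bisim_quotient X)"
proof -
  let ?r = "bisim_rep X" and ?Q = "bisim_quotient X"
  obtain q where q: "epic_covering X ?Q (?r, q)"
    using wf by (rule bisim_quotient_epic_covering)
  have "graph_iso ?Q B f" if f: "epic_covering ?Q B f" for B :: "('a, 'b) pre_digraph" and f
  proof -
    have cov: "covering ?Q B f" using f by (simp add: epic_covering_def)
    \<comment> \<open>Bisimilarity lives on \<open>X\<close>, so \<open>f\<close> is composed with
      the quotient map to compare representatives there.\<close>
    have c: "covering X B (fst f \<circ> ?r, snd f \<circ> q)"
      using covering_comp[OF _ cov, of X "(?r, q)"] q by (simp add: epic_covering_def)
    have inj: "inj_on (fst f) (verts ?Q)"
    proof (rule inj_onI)
      fix u v assume uv: "u \<in> verts ?Q" "v \<in> verts ?Q" "fst f u = fst f v"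
      then obtain x y where "x \<in> verts X" "y \<in> verts X" "u = ?r x" "v = ?r y"
        by (auto simp: bisim_quotient_def)
      then show "u = v"
        using covering_eq_imp_bisimilar[OF c] uv(3) by (auto intro: bisim_rep_eq)
    qed
    show ?thesis
      using cov f inj covering_inj_on_arcs[OF cov inj] epic_covering_arcs[OF f]
      by (intro graph_isoI) (auto simp: bij_betw_def covering_def epic_covering_def)
  qed
  moreover have "wf_digraph ?Q"
    using q by (simp add: epic_covering_def covering_def graph_morphism_def)
  ultimately show ?thesis by (simp add: basal_def)
qed

theorem mainTheorem4:
  fixes X :: "('a, 'b) pre_digraph"
  assumes "wf_digraph X"
  shows "\<exists>(B :: ('a, 'b) pre_digraph) p. basing X B p"
  using bisim_quotient_epic_covering[OF assms] basal_bisim_quotient[OF assms]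
  unfolding basing_def by metis

end
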